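(* Let $G$ be a regular graph and let $H$ be a regular graph on $\Delta(G)$ vertices. Then, for any choice of rotation maps, the replacement product, denoted here $G\,\mathrm{r}\,H$, satisfies $$\mathrm{tww}(G\,\mathrm{r}\,H)\le\mathrm{tww}(G)+\Delta(G).$$
   Context: All graphs are finite and simple (no loops or multiple edges). $\Delta(G)$ is the maximum degree of $G$ (so $G$ is $\Delta(G)$-regular here). Twin-width. A trigraph $G$ has a vertex set $V(G)$, a set $E(G)$ of black edges and a set $R(G)$ of red edges, with $E(G)\cap R(G)=\emptyset$; a graph is a trigraph with no red edges. $N_G(v)$ is the set of vertices joined to $v$ by a black or red edge. A $d$-trigraph is a trigraph in which every vertex is incident with at most $d$ red edges. A contraction merges two distinct (not necessarily adjacent) vertices $u,v$ into a new vertex $w$: every vertex other than $u,v$ in $N_G(u)\triangle N_G(v)$ is joined to $w$ by a red edge; every $x\in N_G(u)\cap N_G(v)$ is joined to $w$ by a black edge if $ux,vx\in E(G)$ and by a red edge otherwise; all edges not incident with $u$ or $v$ are unchanged, and $u,v$ and their incident edges are removed. A $d$-sequence of an $n$-vertex graph $G$ is a sequence of $d$-trigraphs $G_n=G,G_{n-1},\dots,G_1=K_1$ with each $G_{i-1}$ obtained from $G_i$ by one contraction. The twin-width $\mathrm{tww}(G)$ is the least $d$ such that $G$ admits a $d$-sequence. Rotation maps. Let $G$ be a $d$-regular graph with vertex set $[n]$, where at each vertex the incident edges are labelled bijectively by $[d]$ (an edge may receive different labels at its two ends). The rotation map $\mathrm{Rot}_G:[n]\times[d]\to[n]\times[d]$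 is given by $\mathrm{Rot}_G(v,i)=(w,j)$ if the $i$-th edge incident to $v$ leads to $w$ and this edge is the $j$-th edge incident to $w$. Replacement product. Let $G$ be $d$-regular on $[n]$ and $H$ be $\delta$-regular on $[d]$, with rotation maps $\mathrm{Rot}_G,\mathrm{Rot}_H$. The replacement product is the $(\delta+1)$-regular graph on $[n]\times[d]$ whose rotation map sends $((v,k),i)$ to $((v,m),j)$ with $(m,j)=\mathrm{Rot}_H(k,i)$ if $i\le\delta$, and to $(\mathrm{Rot}_G(v,k),i)$ if $i=\delta+1$. Equivalently, $(v,k)$ and $(w,l)$ are adjacent iff [$v=w$ and $kl\in E(H)$] or $\mathrm{Rot}_G(v,k)=(w,l)$. *)

theory Defs
  imports Main
begin

section \<open>Trigraphs and graphs\<close>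

text \<open>Edges are two-element sets of vertices, so loops and multiple edges cannot occur in a
  well-formed trigraph. A graph is a trigraph without red edges.\<close>

record 'a trigraph =
  verts :: "'a set"
  black :: "'a set set"
  red :: "'a set set"

definition trigraph :: "'a trigraph \<Rightarrow> bool" where
  "trigraph T \<longleftrightarrow> finite (verts T)
     \<and> (\<forall>e \<in> black T \<union> red T. e \<subseteq> verts T \<and> card e = 2)
     \<and> black T \<inter> red T = {}"

definition simple_graph :: "'a trigraph \<Rightarrow> bool" where
  "simple_graph G \<longleftrightarrow> trigraph G \<and> red G = {}"

definition incident_edges :: "'a trigraph \<Rightarrow> 'a \<Rightarrow> 'a set set" where
  "incident_edges G v = {e \<in> black G. v \<in> e}"

definition degree :: "'a trigraph \<Rightarrow> 'a \<Rightarrow> nat" where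
  "degree G v = card (incident_edges G v)"

text \<open>On natural numbers \<^term>\<open>Sup {} = (0 :: nat)\<close>, so the maximum degree of the empty graph
  is 0.\<close>

definition max_degree :: "'a trigraph \<Rightarrow> nat" where
  "max_degree G = (SUP v \<in> verts G. degree G v)"

definition regular_graph :: "'a trigraph \<Rightarrow> bool" where
  "regular_graph G \<longleftrightarrow> simple_graph G \<and> (\<exists>d. \<forall>v \<in> verts G. degree G v = d)"


section \<open>Twin-width\<close>

definition nbhd :: "'a trigraph \<Rightarrow> 'a \<Rightarrow> 'a set" where
  "nbhd T v = {x. {v, x} \<in> black T \<union> red T}"

definition red_degree :: "'a trigraph \<Rightarrow> 'a \<Rightarrow> nat" where
  "red_degree T v = card {e \<in> red T. v \<in> e}"

definition d_trigraph :: "nat \<Rightarrow> 'a trigraph \<Rightarrow> bool" where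
  "d_trigraph d T \<longleftrightarrow> trigraph T \<and> (\<forall>v \<in> verts T. red_degree T v \<le> d)"

definition contract :: "'a trigraph \<Rightarrow> 'a \<Rightarrow> 'a \<Rightarrow> 'a \<Rightarrow> 'a trigraph" where
  "contract T u v w =
     \<lparr> verts = insert w (verts T - {u, v}),
       black = {e \<in> black T. u \<notin> e \<and> v \<notin> e}
         \<union> {{w, x} | x. x \<in> nbhd T u \<inter> nbhd T v \<and> {u, x} \<in> black T \<and> {v, x} \<in> black T},
       red = {e \<in> red T. u \<notin> e \<and> v \<notin> e}
         \<union> {{w, x} | x. x \<in> sym_diff (nbhd T u) (nbhd T v) - {u, v}}
         \<union> {{w, x} | x. x \<in> nbhd T u \<inter> nbhd T v \<and> \<not> ({u, x} \<in> black T \<and> {v, x} \<in> black T)} \<rparr>"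

text \<open>The merged vertex \<^term>\<open>w\<close> has to differ from the remaining vertices only. It may reuse
  the name of \<^term>\<open>u\<close> or \<^term>\<open>v\<close>, which no longer denote vertices, so that contractions also
  exist when \<^term>\<open>verts T\<close> exhausts the vertex type.\<close>

definition contracts_to :: "'a trigraph \<Rightarrow> 'a trigraph \<Rightarrow> bool" where
  "contracts_to T T' \<longleftrightarrow>
     (\<exists>u \<in> verts T. \<exists>v \<in> verts T. \<exists>w. u \<noteq> v \<and> w \<notin> verts T - {u, v} \<and> T' = contract T u v w)"

text \<open>\<^term>\<open>Gs i\<close> is the trigraph with \<^term>\<open>i\<close> vertices; values of \<^term>\<open>Gs\<close> outside
  \<^term>\<open>{1 .. card (verts G)}\<close> are irrelevant.\<close>

definition d_sequence :: "nat \<Rightarrow> 'a trigraph \<Rightarrow> (nat \<Rightarrow> 'a trigraph) \<Rightarrow> bool" where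
  "d_sequence d G Gs \<longleftrightarrow>
     (let n = card (verts G) in
       Gs n = G
       \<and> (\<exists>x. Gs 1 = \<lparr> verts = {x}, black = {}, red = {} \<rparr>)
       \<and> (\<forall>i \<in> {1..n}. d_trigraph d (Gs i))
       \<and> (\<forall>i \<in> {2..n}. contracts_to (Gs i) (Gs (i - 1))))"

text \<open>The empty graph cannot be contracted to a single vertex; its twin-width is set to 0.\<close>

definition twin_width :: "'a trigraph \<Rightarrow> nat" where
  "twin_width G =
     (if verts G = {} then 0 else (LEAST d. \<exists>Gs. d_sequence d G Gs))"


section \<open>Rotation maps and the replacement product\<close>

text \<open>\<^term>\<open>lab v i\<close> is the \<^term>\<open>i\<close>-th edge incident to \<^term>\<open>v\<close>. Only the values of
  \<^term>\<open>R\<close> on \<^term>\<open>verts G \<times> {1..max_degree G}\<close> are constrained.\<close>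

definition rotation_map :: "'a trigraph \<Rightarrow> ('a \<times> nat \<Rightarrow> 'a \<times> nat) \<Rightarrow> bool" where
  "rotation_map G R \<longleftrightarrow>
     (\<exists>lab. (\<forall>v \<in> verts G. bij_betw (lab v) {1..max_degree G} (incident_edges G v))
        \<and> (\<forall>v \<in> verts G. \<forall>i \<in> {1..max_degree G}.
             \<exists>w \<in> verts G. \<exists>j \<in> {1..max_degree G}.
               R (v, i) = (w, j) \<and> lab v i = {v, w} \<and> lab w j = {v, w}))"

definition graph_of_rotation_map :: "'a set \<Rightarrow> nat \<Rightarrow> ('a \<times> nat \<Rightarrow> 'a \<times> nat) \<Rightarrow> 'a trigraph" where
  "graph_of_rotation_map V d R =
     \<lparr> verts = V, black = {{x, fst (R (x, i))} | x i. x \<in> V \<and> i \<in> {1..d}}, red = {} \<rparr>"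

definition replacement_rotation ::
    "nat \<Rightarrow> ('a \<times> nat \<Rightarrow> 'a \<times> nat) \<Rightarrow> (nat \<times> nat \<Rightarrow> nat \<times> nat)
      \<Rightarrow> ('a \<times> nat) \<times> nat \<Rightarrow> ('a \<times> nat) \<times> nat" where
  "replacement_rotation \<delta> RG RH = (\<lambda>((v, k), i).
     if i \<le> \<delta> then (let (m, j) = RH (k, i) in ((v, m), j)) else (RG (v, k), i))"

definition replacement_product ::
    "'a trigraph \<Rightarrow> ('a \<times> nat \<Rightarrow> 'a \<times> nat) \<Rightarrow> nat trigraph \<Rightarrow> (nat \<times> nat \<Rightarrow> nat \<times> nat)
      \<Rightarrow> ('a \<times> nat) trigraph" where
  "replacement_product G RG H RH =
     graph_of_rotation_map (verts G \<times> verts H) (max_degree H + 1)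
       (replacement_rotation (max_degree H) RG RH)"

lemma rotation_mapE:
  assumes "rotation_map G R" "v \<in> verts G" "i \<in> {1..max_degree G}"
  obtains w j where "R (v, i) = (w, j)" "w \<in> verts G" "j \<in> {1..max_degree G}"
    "{v, w} \<in> black G" "R (w, j) = (v, i)"
proof -
  from assms(1) obtain lab where
    b: "\<And>v. v \<in> verts G \<Longrightarrow> bij_betw (lab v) {1..max_degree G} (incident_edges G v)" and
    r: "\<And>v i. v \<in> verts G \<Longrightarrow> i \<in> {1..max_degree G} \<Longrightarrow>
             \<exists>w \<in> verts G. \<exists>j \<in> {1..max_degree G}.
               R (v, i) = (w, j) \<and> lab v i = {v, w} \<and> lab w j = {v, w}"
    unfolding rotation_map_def by blast
  from r[OF assms(2,3)] obtain w j where wj: "w \<in> verts G" "j \<in> {1..max_degree G}"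
    "R (v, i) = (w, j)" "lab v i = {v, w}" "lab w j = {v, w}" by blast
  from r[OF wj(1,2)] obtain v' i' where vi: "i' \<in> {1..max_degree G}"
    "R (w, j) = (v', i')" "lab w j = {w, v'}" "lab v' i' = {w, v'}" by blast
  have v': "v' = v" using wj(5) vi(3) by (metis doubleton_eq_iff)
  have "lab v i' = lab v i" using vi(4) wj(4) v' by auto
  hence "i' = i" using b[OF assms(2)] vi(1) assms(3) unfolding bij_betw_def inj_on_def by blast
  hence "R (w, j) = (v, i)" using vi(2) v' by simp
  moreover have "lab v i \<in> incident_edges G v"
    using bij_betwE[OF b[OF assms(2)]] assms(3) by blast
  hence "{v, w} \<in> black G" using wj(4) by (simp add: incident_edges_def)
  ultimately show thesis using that[OF wj(3,1,2)] by blast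
qed

lemma rotation_map_edge:
  assumes "rotation_map G R" "v \<in> verts G" "{v, w} \<in> black G"
  obtains i where "i \<in> {1..max_degree G}" "fst (R (v, i)) = w"
proof -
  from assms(1) obtain lab where
    b: "\<And>v. v \<in> verts G \<Longrightarrow> bij_betw (lab v) {1..max_degree G} (incident_edges G v)" and
    r: "\<And>v i. v \<in> verts G \<Longrightarrow> i \<in> {1..max_degree G} \<Longrightarrow>
             \<exists>w \<in> verts G. \<exists>j \<in> {1..max_degree G}.
               R (v, i) = (w, j) \<and> lab v i = {v, w} \<and> lab w j = {v, w}"
    unfolding rotation_map_def by blast
  have "{v, w} \<in> lab v ` {1..max_degree G}"
    using b[OF assms(2)] assms(3) unfolding bij_betw_def incident_edges_def by auto
  then obtain i where i: "i \<in> {1..max_degree G}" "lab v i = {v, w}" by auto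
  with r[OF assms(2) i(1)] show thesis using that by (metis doubleton_eq_iff fst_conv)
qed

lemma graph_of_rotation_map_blackI:
  assumes "x \<in> V" "i \<in> {1..d}" "fst (R (x, i)) = y"
  shows "{x, y} \<in> black (graph_of_rotation_map V d R)"
  using assms unfolding graph_of_rotation_map_def by auto

text \<open>The direct description of adjacency in the replacement product.\<close>

lemma replacement_product_adj:
  assumes "rotation_map G RG" "rotation_map H RH"
    and "verts H = {1..max_degree G}"
    and "v \<in> verts G" "w \<in> verts G" "k \<in> verts H" "l \<in> verts H"
  shows "{(v, k), (w, l)} \<in> black (replacement_product G RG H RH) \<longleftrightarrow>
    (v = w \<and> {k, l} \<in> black H) \<or> RG (v, k) = (w, l)"
proof
  assume "{(v, k), (w, l)} \<in> black (replacement_product G RG H RH)"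
  then obtain a b i where ab: "a \<in> verts G" "b \<in> verts H" "i \<in> {1..max_degree H + 1}"
    "{(v, k), (w, l)} = {(a, b), fst (replacement_rotation (max_degree H) RG RH ((a, b), i))}"
    unfolding replacement_product_def graph_of_rotation_map_def by auto
  show "(v = w \<and> {k, l} \<in> black H) \<or> RG (v, k) = (w, l)"
  proof (cases "i \<le> max_degree H")
    case True
    then have "i \<in> {1..max_degree H}" using ab(3) by auto
    from rotation_mapE[OF assms(2) ab(2) this] obtain c j where
      "RH (b, i) = (c, j)" "{b, c} \<in> black H" by metis
    then have "{(v, k), (w, l)} = {(a, b), (a, c)}"
      using ab(4) True by (simp add: replacement_rotation_def)
    then show ?thesis using \<open>{b, c} \<in> black H\<close> doubleton_eq_iff[of b c l k]
      by (auto simp: doubleton_eq_iff) (metis insert_commute)+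
  next
    case False
    have "b \<in> {1..max_degree G}" using ab(2) assms(3) by simp
    from rotation_mapE[OF assms(1) ab(1) this] obtain c j where
      "RG (a, b) = (c, j)" "RG (c, j) = (a, b)" by metis
    then show ?thesis using ab(4) False
      by (auto simp: replacement_rotation_def doubleton_eq_iff)
  qed
next
  assume "(v = w \<and> {k, l} \<in> black H) \<or> RG (v, k) = (w, l)"
  then show "{(v, k), (w, l)} \<in> black (replacement_product G RG H RH)"
  proof
    assume a: "v = w \<and> {k, l} \<in> black H"
    from a have "{k, l} \<in> black H" ..
    from rotation_map_edge[OF assms(2,6) this] obtain i where
      i: "i \<in> {1..max_degree H}" "fst (RH (k, i)) = l" by metis
    then have "fst (replacement_rotation (max_degree H) RG RH ((v, k), i)) = (w, l)"
      using a by (auto simp: replacement_rotation_def split: prod.splits)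
    moreover have "i \<in> {1..max_degree H + 1}" using i by auto
    ultimately show ?thesis using graph_of_rotation_map_blackI[of "(v, k)" "verts G \<times> verts H"] assms(4,6)
      unfolding replacement_product_def by (metis SigmaI)
  next
    assume "RG (v, k) = (w, l)"
    then have "fst (replacement_rotation (max_degree H) RG RH ((v, k), max_degree H + 1)) = (w, l)"
      by (auto simp: replacement_rotation_def)
    moreover have "max_degree H + 1 \<in> {1..max_degree H + 1}" by auto
    ultimately show ?thesis using graph_of_rotation_map_blackI[of "(v, k)" "verts G \<times> verts H"] assms(4,6)
      unfolding replacement_product_def by (metis SigmaI)
  qed
qed

end

theory Submission
  imports Defs
begin

text \<open>First merge the vertices of each copy of \<^term>\<open>H\<close> into one, copy after copy; every vertex then
  always has at most \<^term>\<open>max_degree G\<close> neighbours, because a class of \<open>m\<close> members of a copy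
  has at most \<open>m\<close> neighbours outside the copy and \<open>max_degree G - m\<close> inside. What
  remains is \<^term>\<open>G\<close> with its edges possibly turned red; follow an optimal contraction sequence of
  \<^term>\<open>G\<close>. Even if all edges are red, a vertex has red degree at most the red degree in the
  sequence of \<^term>\<open>G\<close> plus the number of black neighbours there, and the latter is at most
  \<^term>\<open>max_degree G\<close>, since each member of the class is adjacent in \<^term>\<open>G\<close> to a member
  of every black neighbour.\<close>

section \<open>Edges, neighbourhoods and red degrees of trigraphs\<close>

lemma trigraph_edgeD:
  assumes "trigraph T" "{x, y} \<in> black T \<union> red T"
  shows "x \<in> verts T" "y \<in> verts T" "x \<noteq> y"
proof -
  from assms have "{x, y} \<subseteq> verts T \<and> card {x, y} = 2"
    unfolding trigraph_def by blast
  then show "x \<in> verts T" "y \<in> verts T" "x \<noteq> y" by (auto split: if_splits)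
qed

lemma trigraph_edgeE:
  assumes "trigraph T" "e \<in> black T \<union> red T"
  obtains x y where "e = {x, y}" "x \<in> verts T" "y \<in> verts T" "x \<noteq> y"
proof -
  from assms have "e \<subseteq> verts T" "card e = 2"
    unfolding trigraph_def by blast+
  then show thesis using that by (auto simp: card_2_iff)
qed

lemma mem_nbhd_commute: "y \<in> nbhd T x \<longleftrightarrow> x \<in> nbhd T y"
  by (simp add: nbhd_def insert_commute)

lemma nbhdD:
  assumes "trigraph T" "y \<in> nbhd T x"
  shows "x \<in> verts T" "y \<in> verts T" "x \<noteq> y"
  using trigraph_edgeD[OF assms(1), of x y] assms(2) by (simp_all add: nbhd_def)

lemma finite_nbhd: "trigraph T \<Longrightarrow> finite (nbhd T x)"
  using nbhdD(2)[of T _ x] by (meson finite_subset subsetI trigraph_def)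

lemma red_degree_conv:
  assumes "trigraph T"
  shows "red_degree T x = card {y. {x, y} \<in> red T}"
proof -
  have "{e \<in> red T. x \<in> e} = (\<lambda>y. {x, y}) ` {y. {x, y} \<in> red T}"
  proof (intro set_eqI iffI)
    fix e assume e: "e \<in> {e \<in> red T. x \<in> e}"
    then have "e \<in> black T \<union> red T" by blast
    then obtain a b where "e = {a, b}" using trigraph_edgeE[OF assms] by metis
    with e show "e \<in> (\<lambda>y. {x, y}) ` {y. {x, y} \<in> red T}"
      by (auto simp: insert_commute)
  qed auto
  moreover have "inj_on (\<lambda>y. {x, y}) {y. {x, y} \<in> red T}"
    by (auto simp: inj_on_def doubleton_eq_iff)
  ultimately show ?thesis
    unfolding red_degree_def by (simp add: card_image)
qed

lemma red_degree_le_card_nbhd: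
  assumes "trigraph T"
  shows "red_degree T x \<le> card (nbhd T x)"
  unfolding red_degree_conv[OF assms]
  by (intro card_mono finite_nbhd[OF assms]) (auto simp: nbhd_def)


section \<open>Contractions\<close>

text \<open>The effect of a contraction on vertices; composites of such maps send each original
  vertex to the class that has absorbed it.\<close>

definition merge :: "'a \<Rightarrow> 'a \<Rightarrow> 'a \<Rightarrow> 'a \<Rightarrow> 'a" where
  "merge u v w z = (if z = u \<or> z = v then w else z)"

locale contraction =
  fixes T :: "'a trigraph" and u v w :: 'a
  assumes tri: "trigraph T"
    and u: "u \<in> verts T" and v: "v \<in> verts T" and uv: "u \<noteq> v"
    and w: "w \<notin> verts T - {u, v}"
begin

lemma verts_contract: "verts (contract T u v w) = merge u v w ` verts T"
  using u v by (auto simp: contract_def merge_def)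

lemma card_verts_contract: "Suc (card (verts (contract T u v w))) = card (verts T)"
proof -
  have f: "finite (verts T)" using tri by (simp add: trigraph_def)
  have "card {u, v} = 2" using uv by simp
  moreover have "card {u, v} \<le> card (verts T)" using u v f by (intro card_mono) auto
  ultimately show ?thesis
    using f u v w by (simp add: contract_def card_Diff_subset)
qed

lemma merge_eq_w_iff: "z \<in> verts T \<Longrightarrow> merge u v w z = w \<longleftrightarrow> z = u \<or> z = v"
  using w by (auto simp: merge_def)

lemma edge_new_vertex:
  assumes "{w, z} \<in> black T \<union> red T"
  shows "w \<in> {u, v}"
  using trigraph_edgeD(1)[OF tri assms] w by blast

lemma no_loop: "{z} \<notin> black T \<union> red T"
  using trigraph_edgeD(3)[OF tri, of z z] by auto

lemma black_contract_iff:
  "{x, y} \<in> black (contract T u v w) \<longleftrightarrow>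
     ({x, y} \<in> black T \<and> x \<notin> {u, v} \<and> y \<notin> {u, v})
   \<or> (x = w \<and> y \<notin> {u, v} \<and> {u, y} \<in> black T \<and> {v, y} \<in> black T)
   \<or> (y = w \<and> x \<notin> {u, v} \<and> {u, x} \<in> black T \<and> {v, x} \<in> black T)"
proof -
  have "z \<notin> {u, v}" if "{u, z} \<in> black T" "{v, z} \<in> black T" for z
    using that no_loop by auto
  then show ?thesis by (auto simp: contract_def nbhd_def doubleton_eq_iff)
qed

lemma red_contract_iff:
  "{x, y} \<in> red (contract T u v w) \<longleftrightarrow>
     ({x, y} \<in> red T \<and> x \<notin> {u, v} \<and> y \<notin> {u, v})
   \<or> (x = w \<and> y \<in> nbhd T u \<union> nbhd T v - {u, v} \<and> \<not> ({u, y} \<in> black T \<and> {v, y} \<in> black T))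
   \<or> (y = w \<and> x \<in> nbhd T u \<union> nbhd T v - {u, v} \<and> \<not> ({u, x} \<in> black T \<and> {v, x} \<in> black T))"
proof -
  \<comment> \<open>Without loops, no common neighbour of \<open>u\<close> and \<open>v\<close> is
    \<open>u\<close> or \<open>v\<close>, so both families of new red edges merge into one condition
    on the union of the neighbourhoods.\<close>
  have "u \<notin> nbhd T u" "v \<notin> nbhd T v" using nbhdD[OF tri] by blast+
  moreover have "z \<in> nbhd T z'" if "{z', z} \<in> black T" for z z'
    using that by (simp add: nbhd_def)
  ultimately show ?thesis
    by (auto simp: contract_def doubleton_eq_iff)
qed

text \<open>With colours forgotten, contraction is an ordinary quotient of graphs;
  \<open>x \<noteq> y\<close> discards the loop that an edge between \<open>u\<close> and
  \<open>v\<close> would leave. In this form contractions compose along a sequence.\<close>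

lemma nbhd_contract_iff:
  "y \<in> nbhd (contract T u v w) x \<longleftrightarrow>
     x \<noteq> y \<and> (\<exists>a b. b \<in> nbhd T a \<and> merge u v w a = x \<and> merge u v w b = y)"
proof
  assume "y \<in> nbhd (contract T u v w) x"
  then consider
      "y \<in> nbhd T x" "x \<notin> {u, v}" "y \<notin> {u, v}"
    | "x = w" "y \<in> nbhd T u \<union> nbhd T v" "y \<notin> {u, v}"
    | "y = w" "x \<in> nbhd T u \<union> nbhd T v" "x \<notin> {u, v}"
    unfolding nbhd_def[of "contract T u v w"]
    by (auto simp: black_contract_iff red_contract_iff nbhd_def)
  then show "x \<noteq> y \<and> (\<exists>a b. b \<in> nbhd T a \<and> merge u v w a = x \<and> merge u v w b = y)"
  proof cases
    case 1
    then show ?thesis using nbhdD[OF tri] by (auto simp: merge_def)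
  next
    case 2
    then have "y \<noteq> w" using nbhdD(2)[OF tri] w by blast
    moreover obtain a where "a \<in> {u, v}" "y \<in> nbhd T a" using 2 by blast
    moreover have "merge u v w a = x" "merge u v w y = y"
      using 2 \<open>a \<in> {u, v}\<close> by (auto simp: merge_def)
    ultimately show ?thesis using 2(1) by metis
  next
    case 3
    then have "x \<noteq> w" using nbhdD(2)[OF tri] w by blast
    moreover obtain b where "b \<in> {u, v}" "x \<in> nbhd T b" using 3 by blast
    moreover from \<open>x \<in> nbhd T b\<close> have "b \<in> nbhd T x" by (metis mem_nbhd_commute)
    moreover have "merge u v w b = y" "merge u v w x = x"
      using 3 \<open>b \<in> {u, v}\<close> by (auto simp: merge_def)
    ultimately show ?thesis using 3(1) by metis
  qed
next
  assume "x \<noteq> y \<and> (\<exists>a b. b \<in> nbhd T a \<and> merge u v w a = x \<and> merge u v w b = y)"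
  then obtain a b where ab: "b \<in> nbhd T a" "merge u v w a = x" "merge u v w b = y" "x \<noteq> y"
    by blast
  have ba: "a \<in> nbhd T b" using ab(1) mem_nbhd_commute by metis
  have *: "{z, w} \<in> black (contract T u v w) \<union> red (contract T u v w)"
    if "z \<in> nbhd T u \<union> nbhd T v" "z \<notin> {u, v}" for z
    using that by (auto simp: black_contract_iff red_contract_iff)
  consider "a \<in> {u, v}" "b \<in> {u, v}" | "a \<in> {u, v}" "b \<notin> {u, v}"
    | "a \<notin> {u, v}" "b \<in> {u, v}" | "a \<notin> {u, v}" "b \<notin> {u, v}" by blast
  then show "y \<in> nbhd (contract T u v w) x"
  proof cases
    case 1
    then show ?thesis using ab by (auto simp: merge_def)
  next
    case 2
    then show ?thesis using ab *[of b] by (auto simp: merge_def nbhd_def insert_commute)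
  next
    case 3
    then have "x = a" "y = w" using ab by (auto simp: merge_def)
    then show ?thesis using ba 3 *[of a] by (auto simp: nbhd_def)
  next
    case 4
    then show ?thesis using ab
      by (auto simp: merge_def nbhd_def black_contract_iff red_contract_iff)
  qed
qed

text \<open>A black edge at \<open>w\<close> requires black edges from both \<open>u\<close> and
  \<open>v\<close>, and all other black edges are old, so blackness passes to every pair of
  preimages.\<close>

lemma black_contractD:
  assumes "{merge u v w a, merge u v w b} \<in> black (contract T u v w)"
    and "a \<in> verts T" "b \<in> verts T"
  shows "{a, b} \<in> black T"
  using assms(1) merge_eq_w_iff[OF assms(2)] merge_eq_w_iff[OF assms(3)]
    edge_new_vertex no_loop
  unfolding black_contract_iff
  by (auto simp: merge_def insert_commute split: if_splits)

lemma trigraph_contract: "trigraph (contract T u v w)"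
proof -
  let ?C = "contract T u v w"
  have pair: "\<exists>x y. e = {x, y}" if "e \<in> black ?C \<union> red ?C" for e
    using that trigraph_edgeE[OF tri, of e] unfolding contract_def by simp blast
  have edge: "x \<in> verts ?C \<and> y \<in> verts ?C \<and> x \<noteq> y" if "y \<in> nbhd ?C x" for x y
    using that nbhdD[OF tri] unfolding nbhd_contract_iff verts_contract by blast
  have "e \<subseteq> verts ?C \<and> card e = 2" if e: "e \<in> black ?C \<union> red ?C" for e
  proof -
    obtain x y where xy: "e = {x, y}" using pair[OF e] by blast
    then have "y \<in> nbhd ?C x" using e by (simp add: nbhd_def)
    from edge[OF this] show ?thesis using xy by simp
  qed
  moreover have "black ?C \<inter> red ?C = {}"
  proof (rule ccontr)
    assume "black ?C \<inter> red ?C \<noteq> {}"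
    then obtain x y where xy: "{x, y} \<in> black ?C" "{x, y} \<in> red ?C" using pair by blast
    have "black T \<inter> red T = {}" using tri by (simp add: trigraph_def)
    \<comment> \<open>An old edge through \<open>w\<close> forces \<open>w \<in> {u, v}\<close>,
      while surviving edges avoid \<open>u\<close> and \<open>v\<close>. So a clash is between two
      surviving edges or two new ones, where the colour conditions exclude each other.\<close>
    then show False
      using xy edge_new_vertex[of x] edge_new_vertex[of y]
      unfolding black_contract_iff red_contract_iff nbhd_def
      by (auto simp: insert_commute)
  qed
  moreover have "finite (verts ?C)"
    using tri by (simp add: contract_def trigraph_def)
  ultimately show ?thesis unfolding trigraph_def by blast
qed

end

lemma contracts_toE:
  assumes "contracts_to T T'" "trigraph T"
  obtains u v w where "contraction T u v w" "T' = contract T u v w"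
proof -
  from assms(1) obtain u v w where
    "u \<in> verts T" "v \<in> verts T" "u \<noteq> v" "w \<notin> verts T - {u, v}" "T' = contract T u v w"
    unfolding contracts_to_def by blast
  then show thesis using that assms(2) by (simp add: contraction_def)
qed

lemma contracts_to_contract: "contraction T u v w \<Longrightarrow> contracts_to T (contract T u v w)"
  unfolding contracts_to_def contraction_def by metis


section \<open>Contraction sequences\<close>

text \<open>A contraction sequence without indices, so that statements about sequences become rule
  inductions. The final single vertex has no red edges and thus meets every bound.\<close>

inductive contractible :: "nat \<Rightarrow> 'a trigraph \<Rightarrow> bool" for d where
  single: "contractible d \<lparr> verts = {x}, black = {}, red = {} \<rparr>"
| step: "d_trigraph d T \<Longrightarrow> contracts_to T T' \<Longrightarrow> contractible d T' \<Longrightarrow> contractible d T"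

lemma d_sequence_if_contractible:
  "contractible d T \<Longrightarrow> \<exists>Gs. d_sequence d T Gs"
proof (induction rule: contractible.induct)
  case (single x)
  let ?T = "\<lparr> verts = {x}, black = {}, red = {} \<rparr>"
  have "d_sequence d ?T (\<lambda>_. ?T)"
    by (auto simp: d_sequence_def d_trigraph_def trigraph_def red_degree_def)
  then show ?case by blast
next
  case (step T T')
  then obtain Gs where Gs: "d_sequence d T' Gs" by blast
  have tri: "trigraph T" using step(1) by (simp add: d_trigraph_def)
  obtain u v w where c: "contraction T u v w" and T': "T' = contract T u v w"
    using contracts_toE[OF step(2) tri] by blast
  have card: "card (verts T) = Suc (card (verts T'))"
    using contraction.card_verts_contract[OF c] T' by simp
  have "finite (verts T')" "verts T' \<noteq> {}"
    using contraction.trigraph_contract[OF c] T' by (auto simp: trigraph_def contract_def)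
  then have pos: "card (verts T') \<ge> 1" by (simp add: Suc_leI card_gt_0_iff)
  \<comment> \<open>Entries are indexed by vertex count, so \<open>T\<close> only fills the position
    above \<open>T'\<close>; \<open>pos\<close> keeps position 1 untouched.\<close>
  have "d_sequence d T (Gs(card (verts T) := T))"
    using Gs pos step(1,2) unfolding d_sequence_def Let_def card
    by (auto simp: le_Suc_eq)
  then show ?case by blast
qed

lemma contractible_if_d_sequence:
  assumes "d_sequence d T Gs" "card (verts T) \<ge> 1"
  shows "contractible d T"
proof -
  have "contractible d (Gs i)" if "1 \<le> i" "i \<le> card (verts T)" for i
    using that
  proof (induction i rule: nat_induct_at_least)
    case base
    then show ?case using assms(1) by (auto simp: d_sequence_def Let_def intro: single)
  next
    case (Suc i)
    then have "Suc i \<in> {1..card (verts T)}" "Suc i \<in> {2..card (verts T)}" by auto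
    then have "d_trigraph d (Gs (Suc i))" "contracts_to (Gs (Suc i)) (Gs (Suc i - 1))"
      using assms(1) unfolding d_sequence_def Let_def by blast+
    then show ?case using Suc by (auto intro: step)
  qed
  from this[OF assms(2)] show ?thesis using assms(1) by (simp add: d_sequence_def Let_def)
qed

lemma trigraph_single:
  assumes "trigraph T" "verts T = {x}"
  shows "T = \<lparr> verts = {x}, black = {}, red = {} \<rparr>"
proof -
  have "black T \<union> red T = {}"
    using trigraph_edgeE[OF assms(1)] assms(2) by (metis equals0I singletonD)
  then show ?thesis using assms(2) by simp
qed

text \<open>Any order of contractions works, since a red degree never exceeds the number of
  vertices. This supplies the witness without which the \<open>LEAST\<close> in
  \<open>twin_width\<close> would say nothing.\<close>

lemma contractible_card_verts:
  assumes "trigraph T" "verts T \<noteq> {}" "card (verts T) \<le> d"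
  shows "contractible d T"
  using assms
proof (induction "card (verts T)" arbitrary: T)
  case 0
  then show ?case by (simp add: trigraph_def)
next
  case (Suc m)
  have fin: "finite (verts T)" using Suc by (simp add: trigraph_def)
  obtain u where u: "u \<in> verts T" using Suc by blast
  show ?case
  proof (cases "verts T = {u}")
    case True
    show ?thesis using trigraph_single[OF Suc(3) True] by (metis single)
  next
    case False
    then obtain v where v: "v \<in> verts T" "u \<noteq> v" using u by blast
    have c: "contraction T u v u" using u v Suc by (simp add: contraction_def)
    have "red_degree T x \<le> d" for x
    proof -
      have "card (nbhd T x) \<le> card (verts T)"
        using nbhdD(2)[OF Suc(3)] by (intro card_mono fin) blast
      then show ?thesis using red_degree_le_card_nbhd[OF Suc(3), of x] Suc(5) by linarith
    qed
    then have "d_trigraph d T" using Suc by (simp add: d_trigraph_def)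
    moreover have "contractible d (contract T u v u)"
    proof (rule Suc(1))
      show "m = card (verts (contract T u v u))"
        using contraction.card_verts_contract[OF c] Suc(2) by simp
      then show "card (verts (contract T u v u)) \<le> d" using Suc by simp
    qed (use contraction.trigraph_contract[OF c] in \<open>auto simp: contract_def\<close>)
    ultimately show ?thesis using contracts_to_contract[OF c] by (metis step)
  qed
qed

lemma contractible_twin_width:
  assumes "trigraph T" "verts T \<noteq> {}"
  shows "contractible (twin_width T) T"
proof -
  have "\<exists>Gs. d_sequence (card (verts T)) T Gs"
    using d_sequence_if_contractible contractible_card_verts assms by blast
  then have "\<exists>Gs. d_sequence (twin_width T) T Gs"
    using assms(2) LeastI[of "\<lambda>d. \<exists>Gs. d_sequence d T Gs"] by (auto simp: twin_width_def)
  moreover have "card (verts T) \<ge> 1"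
    using assms by (simp add: Suc_leI card_gt_0_iff trigraph_def)
  ultimately show ?thesis using contractible_if_d_sequence by blast
qed

lemma twin_width_le_if_contractible: "contractible d T \<Longrightarrow> twin_width T \<le> d"
  using d_sequence_if_contractible[of d T]
  by (auto simp: twin_width_def intro: Least_le)


section \<open>Quotients\<close>

text \<open>Black edges of \<^term>\<open>T\<close> have to join completely adjacent classes, but completely adjacent
  classes may also be joined by a red edge: contractions never turn red edges black again.\<close>

definition quotient_of :: "'a trigraph \<Rightarrow> ('a \<Rightarrow> 'b) \<Rightarrow> 'b trigraph \<Rightarrow> bool" where
  "quotient_of G p T \<longleftrightarrow> trigraph T \<and> verts T = p ` verts G
     \<and> (\<forall>x y. y \<in> nbhd T x \<longleftrightarrow> x \<noteq> y \<and> (\<exists>a b. b \<in> nbhd G a \<and> p a = x \<and> p b = y))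
     \<and> (\<forall>a \<in> verts G. \<forall>b \<in> verts G. {p a, p b} \<in> black T \<longrightarrow> {a, b} \<in> black G)"

lemma
  assumes "quotient_of G p T"
  shows quotient_of_trigraph: "trigraph T"
    and quotient_of_verts: "verts T = p ` verts G"
    and quotient_of_nbhd_iff:
      "y \<in> nbhd T x \<longleftrightarrow> x \<noteq> y \<and> (\<exists>a b. b \<in> nbhd G a \<and> p a = x \<and> p b = y)"
    and quotient_of_black: "a \<in> verts G \<Longrightarrow> b \<in> verts G \<Longrightarrow> {p a, p b} \<in> black T \<Longrightarrow> {a, b} \<in> black G"
  using assms unfolding quotient_of_def by simp_all

lemma quotient_of_refl: "trigraph G \<Longrightarrow> quotient_of G (\<lambda>x. x) G"
  using nbhdD(3)[of G] by (auto simp: quotient_of_def)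

lemma quotient_of_contract:
  assumes "quotient_of G p T" "contraction T u v w" "trigraph G"
  shows "quotient_of G (\<lambda>z. merge u v w (p z)) (contract T u v w)"
proof -
  interpret contraction T u v w by fact
  note q = quotient_of_verts[OF assms(1)] quotient_of_nbhd_iff[OF assms(1)]
    quotient_of_black[OF assms(1)]
  \<comment> \<open>Classes that stay distinct after merging were distinct before, so the two
    inequalities reduce to the outer one.\<close>
  have "y \<in> nbhd (contract T u v w) x \<longleftrightarrow>
      x \<noteq> y \<and> (\<exists>a b. b \<in> nbhd G a \<and> merge u v w (p a) = x \<and> merge u v w (p b) = y)" for x y
    unfolding nbhd_contract_iff q(2) by metis
  moreover have "{a, b} \<in> black G"
    if "a \<in> verts G" "b \<in> verts G"
      "{merge u v w (p a), merge u v w (p b)} \<in> black (contract T u v w)" for a b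
    using q(3)[OF that(1,2)] black_contractD[OF that(3)] that(1,2) q(1) by simp
  ultimately show ?thesis
    unfolding quotient_of_def
    using trigraph_contract verts_contract q(1) by (simp add: image_image)
qed

text \<open>Used to replace iterated merges by closed formulas for the class of a vertex, which
  agree with them only on vertices.\<close>

lemma quotient_of_cong:
  assumes "quotient_of G p T" "trigraph G" "\<And>z. z \<in> verts G \<Longrightarrow> p z = p' z"
  shows "quotient_of G p' T"
proof -
  have "(\<exists>a b. b \<in> nbhd G a \<and> p a = x \<and> p b = y) \<longleftrightarrow>
      (\<exists>a b. b \<in> nbhd G a \<and> p' a = x \<and> p' b = y)" for x y
    using nbhdD[OF assms(2)] assms(3) by metis
  then show ?thesis
    using assms(1,3) unfolding quotient_of_def by simp
qed

lemma card_nbhd_quotient_le: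
  assumes "quotient_of G p T" "d_trigraph t T" "x \<in> verts T"
    and deg: "\<And>a. a \<in> verts G \<Longrightarrow> card {b. {a, b} \<in> black G} \<le> D"
    and tri: "trigraph G"
  shows "card (nbhd T x) \<le> t + D"
proof -
  have T: "trigraph T" using assms(2) by (simp add: d_trigraph_def)
  obtain a where a: "a \<in> verts G" "x = p a"
    using assms(1,3) by (auto simp: quotient_of_verts)
  have fin: "finite {b. {a, b} \<in> black G}"
    using finite_nbhd[OF tri, of a] by (rule rev_finite_subset) (auto simp: nbhd_def)
  \<comment> \<open>A single member \<open>a\<close> of the class suffices: a black edge joins
    completely adjacent classes, so each black neighbour of \<open>x\<close> contains a neighbour of
    \<open>a\<close>.\<close>
  have "{y. {x, y} \<in> black T} \<subseteq> p ` {b. {a, b} \<in> black G}"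
  proof
    fix y assume y: "y \<in> {y. {x, y} \<in> black T}"
    then have "y \<in> verts T" using trigraph_edgeD(2)[OF T] by blast
    then obtain b where "b \<in> verts G" "y = p b" using assms(1) by (auto simp: quotient_of_verts)
    then show "y \<in> p ` {b. {a, b} \<in> black G}"
      using quotient_of_black[OF assms(1) a(1), of b] a y by auto
  qed
  then have "card {y. {x, y} \<in> black T} \<le> D"
    using fin deg[OF a(1)] by (meson card_image_le card_mono finite_imageI le_trans)
  moreover have "card {y. {x, y} \<in> red T} \<le> t"
    using assms(2,3) red_degree_conv[OF T] by (simp add: d_trigraph_def)
  moreover have "nbhd T x = {y. {x, y} \<in> red T} \<union> {y. {x, y} \<in> black T}"
    by (auto simp: nbhd_def)
  ultimately show ?thesis
    using card_Un_le[of "{y. {x, y} \<in> red T}" "{y. {x, y} \<in> black T}"] by simp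
qed


section \<open>The replacement product\<close>

text \<open>\<open>D_pos\<close> makes every copy of \<open>H\<close> nonempty, so that the first
  projection maps the product onto \<open>verts G\<close>.\<close>

locale replacement =
  fixes G H :: "nat trigraph" and RG RH :: "nat \<times> nat \<Rightarrow> nat \<times> nat"
  assumes G: "trigraph G" and H: "trigraph H"
    and verts_H: "verts H = {1..max_degree G}"
    and RG: "rotation_map G RG" and RH: "rotation_map H RH"
    and D_pos: "max_degree G > 0"
begin

abbreviation "D \<equiv> max_degree G"

definition "P = replacement_product G RG H RH"

lemma verts_P: "verts P = verts G \<times> {1..D}"
  by (simp add: P_def replacement_product_def graph_of_rotation_map_def verts_H)

lemma red_P: "red P = {}"
  by (simp add: P_def replacement_product_def graph_of_rotation_map_def)

lemma trigraph_P: "trigraph P"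
proof -
  have "e \<subseteq> verts P \<and> card e = 2" if "e \<in> black P" for e
  proof -
    from that obtain v k i where e: "v \<in> verts G" "k \<in> {1..D}" "i \<in> {1..max_degree H + 1}"
      "e = {(v, k), fst (replacement_rotation (max_degree H) RG RH ((v, k), i))}"
      by (auto simp: P_def replacement_product_def graph_of_rotation_map_def verts_H)
    show ?thesis
    proof (cases "i \<le> max_degree H")
      case True
      with e verts_H have "k \<in> verts H" "i \<in> {1..max_degree H}" by auto
      from rotation_mapE[OF RH this] obtain m j where
        m: "RH (k, i) = (m, j)" "m \<in> verts H" "{k, m} \<in> black H" by metis
      then have "k \<noteq> m" using trigraph_edgeD(3)[OF H] by blast
      then show ?thesis using m e True
        by (simp add: replacement_rotation_def verts_P verts_H)
    next
      case False
      from rotation_mapE[OF RG e(1,2)] obtain w j where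
        m: "RG (v, k) = (w, j)" "w \<in> verts G" "j \<in> {1..D}" "{v, w} \<in> black G" by metis
      then have "v \<noteq> w" using trigraph_edgeD(3)[OF G] by blast
      then show ?thesis using m e False
        by (simp add: replacement_rotation_def verts_P)
    qed
  qed
  moreover have "finite (verts P)" using G by (simp add: verts_P trigraph_def)
  ultimately show ?thesis by (simp add: trigraph_def red_P)
qed

text \<open>The form of adjacency used for counting: at most one neighbour of a vertex lies outside
  its copy, and the rotation map names it.\<close>

lemma nbhd_P_cases:
  assumes "b \<in> nbhd P a"
  obtains "fst b = fst a" | "b = RG a"
proof -
  obtain v k w l where ab: "a = (v, k)" "b = (w, l)" by fastforce
  have "a \<in> verts P" "b \<in> verts P" using nbhdD[OF trigraph_P assms] by blast+
  then show thesis
    using replacement_product_adj[OF RG RH verts_H, of v w k l] assms that ab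
    unfolding P_def[symmetric] by (auto simp: nbhd_def red_P verts_P verts_H)
qed

lemma nbhd_G_RG:
  assumes "a \<in> verts P"
  shows "fst (RG a) \<in> nbhd G (fst a)"
  using assms rotation_mapE[OF RG, of "fst a" "snd a"]
  by (auto simp: verts_P nbhd_def) (metis fst_conv)

lemma card_black_nbhd_G:
  assumes "v \<in> verts G"
  shows "card {w. {v, w} \<in> black G} \<le> D"
proof -
  have "{w. {v, w} \<in> black G} \<subseteq> (\<lambda>i. fst (RG (v, i))) ` {1..D}"
    using rotation_map_edge[OF RG assms] by (metis (mono_tags, lifting) image_eqI mem_Collect_eq subsetI)
  then have "card {w. {v, w} \<in> black G} \<le> card {1..D}"
    by (rule surj_card_le[rotated]) simp
  then show ?thesis by simp
qed

section \<open>Second phase: following a contraction sequence of \<open>G\<close>\<close>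

text \<open>\<open>T'\<close> mirrors \<open>T\<close>, with 1 as second coordinate because the
  vertices keep the type \<open>nat \<times> nat\<close>; each contraction of \<open>T\<close> is
  copied in \<open>T'\<close>. Edges that are black in \<open>T\<close> may be red in
  \<open>T'\<close>, and the summand \<open>D\<close> pays for them.\<close>

lemma contractible_collapsed:
  assumes "contractible t T" "quotient_of G p T" "quotient_of P (\<lambda>z. (p (fst z), 1 :: nat)) T'"
    and red: "red G = {}"
  shows "contractible (t + D) T'"
  using assms(1-3)
proof (induction arbitrary: p T' rule: contractible.induct)
  case (single x)
  have "p ` verts G = {x}" using quotient_of_verts[OF single(1)] by simp
  moreover have "verts T' = (\<lambda>x. (x, 1)) ` p ` fst ` verts P"
    using quotient_of_verts[OF single(2)] by (simp add: image_image)
  moreover have "fst ` verts P = verts G" using D_pos by (simp add: verts_P fst_image_times)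
  ultimately have "verts T' = {(x, 1)}" by simp
  then show ?case using trigraph_single[of T'] single(2) contractible.single
    by (metis quotient_of_trigraph)
next
  case (step T T1)
  have T: "trigraph T" using step(1) by (simp add: d_trigraph_def)
  note T' = quotient_of_trigraph[OF step.prems(2)]
  have img: "fst ` verts P = verts G" using D_pos by (simp add: verts_P fst_image_times)
  have verts_T': "verts T' = (\<lambda>x. (x, 1)) ` verts T"
  proof -
    have "verts T' = (\<lambda>x. (x, 1)) ` p ` fst ` verts P"
      using quotient_of_verts[OF step.prems(2)] by (simp add: image_image)
    then show ?thesis by (simp only: img quotient_of_verts[OF step.prems(1)])
  qed
  have nbhd_T': "nbhd T' (x, 1) \<subseteq> (\<lambda>y. (y, 1)) ` nbhd T x" for x
  proof
    fix y assume y: "y \<in> nbhd T' (x, 1)"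
    then obtain a b where "b \<in> nbhd P a" "(p (fst a), 1 :: nat) = (x, 1)"
      "(p (fst b), 1) = y" "(x, 1) \<noteq> y"
      unfolding quotient_of_nbhd_iff[OF step.prems(2)] by (elim conjE exE)
    then have ab: "b \<in> nbhd P a" "p (fst a) = x" "y = (p (fst b), 1)" "(x, 1) \<noteq> y" by auto
    \<comment> \<open>Ends in one copy would have equal images under \<open>p\<close>, against
      \<open>(x, 1) \<noteq> y\<close>; so the edge comes from the rotation map and projects to an
      edge of \<open>G\<close>.\<close>
    then have "fst b \<in> nbhd G (fst a)"
      using nbhd_P_cases[OF ab(1)] nbhd_G_RG nbhdD(1)[OF trigraph_P ab(1)] by metis
    then have "p (fst b) \<in> nbhd T x"
      unfolding quotient_of_nbhd_iff[OF step.prems(1)] using ab by auto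
    then show "y \<in> (\<lambda>y. (y, 1)) ` nbhd T x" using ab by blast
  qed
  have "red_degree T' z \<le> t + D" if z: "z \<in> verts T'" for z
  proof -
    obtain x where x: "x \<in> verts T" "z = (x, 1)" using z by (auto simp: verts_T')
    have "red_degree T' z \<le> card (nbhd T' z)" by (rule red_degree_le_card_nbhd[OF T'])
    also have "\<dots> \<le> card (nbhd T x)"
      using nbhd_T'[of x] x finite_nbhd[OF T] by (simp add: surj_card_le)
    also have "\<dots> \<le> t + D"
      using card_nbhd_quotient_le[OF step.prems(1) step(1) x(1) card_black_nbhd_G G] by blast
    finally show ?thesis .
  qed
  then have "d_trigraph (t + D) T'" using T' by (simp add: d_trigraph_def)
  moreover obtain u v w where c: "contraction T u v w" and T1: "T1 = contract T u v w"
    using contracts_toE[OF step(2) T] by blast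
  have c': "contraction T' (u, 1) (v, 1) (w, 1)"
    using c T' verts_T' by (auto simp: contraction_def)
  have "quotient_of P (\<lambda>z. merge (u, 1) (v, 1) (w, 1) (p (fst z), 1)) (contract T' (u, 1) (v, 1) (w, 1))"
    using quotient_of_contract[OF step.prems(2) c' trigraph_P] by simp
  \<comment> \<open>On pairs with second coordinate 1, merging acts on first coordinates only, so
    the map regains the shape that the induction hypothesis asks for.\<close>
  then have "quotient_of P (\<lambda>z. (merge u v w (p (fst z)), 1)) (contract T' (u, 1) (v, 1) (w, 1))"
    by (rule quotient_of_cong[OF _ trigraph_P]) (simp add: merge_def)
  then have "contractible (t + D) (contract T' (u, 1) (v, 1) (w, 1))"
    using step.IH quotient_of_contract[OF step.prems(1) c G] T1 by blast
  ultimately show ?case using contracts_to_contract[OF c'] contractible.step by blast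
qed

section \<open>First phase: collapsing the copies of \<open>H\<close> vertex by vertex\<close>

text \<open>\<open>M\<close> collects the vertices already absorbed by the vertex with label 1 of
  their copy, which serves as the representative.\<close>

definition collapse :: "(nat \<times> nat) set \<Rightarrow> nat \<times> nat \<Rightarrow> nat \<times> nat" where
  "collapse M z = (if z \<in> M then (fst z, 1) else z)"

lemma fst_collapse [simp]: "fst (collapse M z) = fst z"
  by (simp add: collapse_def)

lemma card_nbhd_collapse_le:
  assumes "quotient_of P (collapse M) T"
  shows "card (nbhd T x) \<le> D"
proof -
  \<comment> \<open>The members of the class \<^term>\<open>x\<close> account for its neighbours outside the copy, the other
    vertices of the copy for those inside.\<close>
  define f where "f a = (if collapse M a = x then collapse M (RG a) else collapse M a)" for a
  have "nbhd T x \<subseteq> f ` ({fst x} \<times> {1..D})"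
  proof
    fix y assume "y \<in> nbhd T x"
    then obtain a b where ab: "b \<in> nbhd P a" "collapse M a = x" "y = collapse M b" "x \<noteq> y"
      unfolding quotient_of_nbhd_iff[OF assms] by auto
    have V: "a \<in> verts P" "b \<in> verts P" using nbhdD[OF trigraph_P ab(1)] by blast+
    have fa: "fst a = fst x" using ab(2) fst_collapse by metis
    from ab(1) show "y \<in> f ` ({fst x} \<times> {1..D})"
    proof (cases rule: nbhd_P_cases)
      case 1
      \<comment> \<open>\<open>b\<close> is outside the class \<open>x\<close>, so \<open>f\<close>
        returns the class of \<open>b\<close> itself.\<close>
      have "y = f b" using ab by (simp add: f_def)
      moreover have "b \<in> {fst x} \<times> {1..D}" using V fa 1 by (auto simp: verts_P)
      ultimately show ?thesis by blast
    next
      case 2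
      have "y = f a" using ab 2 by (simp add: f_def)
      moreover have "a \<in> {fst x} \<times> {1..D}" using V fa by (auto simp: verts_P)
      ultimately show ?thesis by blast
    qed
  qed
  then have "card (nbhd T x) \<le> card ({fst x} \<times> {1..D})"
    by (rule surj_card_le[rotated]) simp
  then show ?thesis by (simp add: card_cartesian_product)
qed

text \<open>Induction on the number of vertices still to be absorbed; once none is left, the second
  phase takes over with the identity map on \<open>G\<close>. Until then every red degree is at most
  \<open>D\<close>.\<close>

lemma contractible_partially_collapsed:
  assumes "contractible t G" "red G = {}" "quotient_of P (collapse M) T"
    and "M \<subseteq> verts G \<times> {2..D}"
  shows "contractible (t + D) T"
  using assms(3,4)
proof (induction "card (verts G \<times> {2..D} - M)" arbitrary: M T rule: less_induct)
  case less
  show ?case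
  proof (cases "M = verts G \<times> {2..D}")
    case True
    have "quotient_of P (\<lambda>z. (fst z, 1)) T"
      by (rule quotient_of_cong[OF less(2) trigraph_P])
        (auto simp: collapse_def verts_P True)
    from contractible_collapsed[OF assms(1) quotient_of_refl[OF G] this assms(2)]
    show ?thesis .
  next
    case False
    then obtain v k where vk: "v \<in> verts G" "k \<in> {2..D}" "(v, k) \<notin> M" using less(3) by blast
    let ?M = "insert (v, k) M"
    note T = quotient_of_trigraph[OF less(2)]
    have "red_degree T x \<le> t + D" for x
      using red_degree_le_card_nbhd[OF T, of x] card_nbhd_collapse_le[OF less(2), of x] by linarith
    then have dT: "d_trigraph (t + D) T" using T by (simp add: d_trigraph_def)
    have "collapse M (v, 1) = (v, 1)" "collapse M (v, k) = (v, k)"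
      using vk by (simp_all add: collapse_def)
    moreover have "(v, 1) \<in> verts P" "(v, k) \<in> verts P" using vk by (auto simp: verts_P)
    ultimately have "(v, 1) \<in> verts T" "(v, k) \<in> verts T"
      using quotient_of_verts[OF less(2)] by (metis imageI)+
    then have c: "contraction T (v, 1) (v, k) (v, 1)"
      using T vk by (auto simp: contraction_def)
    \<comment> \<open>The merged vertex keeps the name \<open>(v, 1)\<close>, so on vertices
      \<open>collapse M\<close> followed by the merge is \<open>collapse ?M\<close>.\<close>
    have "quotient_of P (collapse ?M) (contract T (v, 1) (v, k) (v, 1))"
      by (rule quotient_of_cong[OF quotient_of_contract[OF less(2) c trigraph_P] trigraph_P])
        (use vk less(3) in \<open>auto simp: collapse_def merge_def\<close>)
    moreover have "card (verts G \<times> {2..D} - ?M) < card (verts G \<times> {2..D} - M)"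
      using vk G by (intro psubset_card_mono) (auto simp: trigraph_def)
    ultimately have "contractible (t + D) (contract T (v, 1) (v, k) (v, 1))"
      using less(1)[of ?M] less(3) vk by auto
    then show ?thesis using dT contracts_to_contract[OF c] step by blast
  qed
qed

lemma twin_width_P_le:
  assumes "red G = {}" "verts G \<noteq> {}"
  shows "twin_width P \<le> twin_width G + D"
proof (rule twin_width_le_if_contractible)
  have "quotient_of P (collapse {}) P"
    by (rule quotient_of_cong[OF quotient_of_refl[OF trigraph_P] trigraph_P])
      (simp add: collapse_def)
  then show "contractible (twin_width G + D) P"
    using contractible_partially_collapsed contractible_twin_width[OF G] assms by blast
qed

end

theorem theorem4p2:
  fixes G H :: "nat trigraph" and n :: nat
    and RG RH :: "nat \<times> nat \<Rightarrow> nat \<times> nat"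
  assumes "regular_graph G" and "verts G = {1..n}"
    and "regular_graph H" and "verts H = {1..max_degree G}"
    and "rotation_map G RG" and "rotation_map H RH"
  shows "twin_width (replacement_product G RG H RH) \<le> twin_width G + max_degree G"
proof (cases "verts G = {} \<or> max_degree G = 0")
  case True
  \<comment> \<open>If the degree is 0, then \<open>H\<close> has vertex set \<open>{1..0}\<close>;
    so in either case the product is empty and its twin-width is 0 by convention.\<close>
  then have "verts (replacement_product G RG H RH) = {}"
    using assms(4) by (auto simp: replacement_product_def graph_of_rotation_map_def)
  then show ?thesis by (simp add: twin_width_def)
next
  case False
  interpret replacement G H RG RH
    using assms False by unfold_locales (auto simp: regular_graph_def simple_graph_def)
  show ?thesis
    using twin_width_P_le assms(1) False by (simp add: P_def regular_graph_def simple_graph_def)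
qed

end
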